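(* Let $L>0$, let $f\colon\mathbb{R}^n\to\mathbb{R}$ be convex and $L$-smooth, and let $f_\star=\inf_{x\in\mathbb{R}^n}f(x)$. Let $K\ge1$ be an integer. Let $\{\varphi_k\}_{k=0}^{K+1}$ be a nonnegative sequence and $\{\tau_k\}_{k=0}^{K}$ a nondecreasing nonnegative sequence such that $\varphi_{K+1}=0$, $\varphi_K=\tau_K=1$, and, for $k=0,1,\dots,K-1$, $$\tau_k\varphi_k-\tau_{k+1}\varphi_{k+1}=\varphi_{k+1}(\tau_{k+1}-\tau_k)+1,\qquad(\tau_k\varphi_k-\tau_{k+1}\varphi_{k+1})(\tau_{k+1}-\tau_k)\le\tau_{k+1}.$$ Let $x_0\in\mathbb{R}^n$, $z_0=x_0$, $x_{-1}^{+}:=x_0$, and let the iterates be generated by G-FGM-G: $$x_k=\frac{\varphi_{k+1}}{\varphi_k}x_{k-1}^{+}+\left(1-\frac{\varphi_{k+1}}{\varphi_k}\right)z_k\quad(k=0,\dots,K),\qquad z_{k+1}=z_k-\frac{\tau_k\varphi_k-\tau_{k+1}\varphi_{k+1}}{L}\nabla f(x_k)\quad(k=0,\dots,K-1).$$ Then $$\|\nabla f(x_K)\|^2\le2L\tau_0\left(f(x_0)-f_\star\right).$$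
   Context: $\|\cdot\|$ is the Euclidean norm. $f$ is $L$-smooth if it is differentiable and $\nabla f$ is $L$-Lipschitz. $x^+=x-\frac1L\nabla f(x)$, and $x_k^+=(x_k)^+$ for $k\ge0$. *)

theory Defs
  imports "HOL-Analysis.Analysis"
begin

definition grad :: "('a::real_inner \<Rightarrow> real) \<Rightarrow> 'a \<Rightarrow> 'a" where
  "grad f x = (THE D. GDERIV f x :> D)"

(* grad is meaningful wherever f is differentiable *)
lemma GDERIV_grad:
  fixes f :: "'a::euclidean_space \<Rightarrow> real"
  assumes "f differentiable (at x)"
  shows "GDERIV f x :> grad f x"
proof -
  obtain f' where f': "(f has_derivative f') (at x)"
    using assms by (auto simp: differentiable_def)
  then interpret f': bounded_linear f' by (rule has_derivative_bounded_linear)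
  define D where "D = (\<Sum>b\<in>Basis. f' b *\<^sub>R b)"
  have "f' h = h \<bullet> D" for h
  proof -
    have "f' h = f' (\<Sum>b\<in>Basis. (h \<bullet> b) *\<^sub>R b)"
      by (simp add: euclidean_representation)
    also have "\<dots> = (\<Sum>b\<in>Basis. (h \<bullet> b) * f' b)"
      unfolding f'.sum f'.scaleR by simp
    also have "\<dots> = h \<bullet> D"
      by (simp add: D_def inner_sum_right mult.commute)
    finally show ?thesis .
  qed
  then have "f' = (\<lambda>h. h \<bullet> D)" by auto
  with f' have D: "GDERIV f x :> D" by (simp add: gderiv_def)
  have "D' = D" if "GDERIV f x :> D'" for D'
  proof -
    have "(\<lambda>h. h \<bullet> D') = (\<lambda>h. h \<bullet> D)"
      using that D unfolding gderiv_def by (rule has_derivative_unique)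
    then have "h \<bullet> D' = h \<bullet> D" for h by (rule fun_cong)
    then show ?thesis using vector_eq_ldot[of D' D] by blast
  qed
  with D have "grad f x = D" unfolding grad_def by (rule the_equality)
  with D show ?thesis by simp
qed

definition smooth_fun :: "real \<Rightarrow> ('a::real_inner \<Rightarrow> real) \<Rightarrow> bool" where
  "smooth_fun L f \<longleftrightarrow> (\<forall>x. f differentiable (at x)) \<and> L-lipschitz_on UNIV (grad f)"

definition grad_step :: "real \<Rightarrow> ('a::real_inner \<Rightarrow> real) \<Rightarrow> 'a \<Rightarrow> 'a" where
  "grad_step L f x = x - (1 / L) *\<^sub>R grad f x"

(* prev_plus L f x k stands for x_{k-1}^+, with the convention x_{-1}^+ = x_0 *)
primrec prev_plus :: "real \<Rightarrow> ('a::real_inner \<Rightarrow> real) \<Rightarrow> (nat \<Rightarrow> 'a) \<Rightarrow> nat \<Rightarrow> 'a" where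
  "prev_plus L f x 0 = x 0"
| "prev_plus L f x (Suc k) = grad_step L f (x k)"

(* Extended-real infimum: equals -\<infinity> when f is unbounded below,
   whereas Inf on type real would be unspecified there. *)
definition inf_value :: "('a \<Rightarrow> real) \<Rightarrow> ereal" where
  "inf_value f = (INF x. ereal (f x))"

end

theory Submission
  imports Defs
begin

text \<open>
  Write \<open>g\<^sub>k\<close> for the gradient at \<open>x\<^sub>k\<close>. The potential
  \<open>U\<^sub>k = \<tau>\<^sub>k (|g\<^sub>K|\<^sup>2 / 2L + |g\<^sub>k|\<^sup>2 / 2L + f x\<^sub>k - f x\<^sub>K - \<langle>g\<^sub>k, x\<^sub>k - x\<^sub>k\<^sub>-\<^sub>1\<^sup>+\<rangle>)
    + (L / \<phi>\<^sub>k) \<langle>z\<^sub>k - x\<^sub>k\<^sub>-\<^sub>1\<^sup>+, z\<^sub>k - x\<^sub>K\<^sup>+\<rangle>\<close>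
  is nonincreasing: add the cocoercivity inequality for the pair \<open>(x\<^sub>k, x\<^sub>k\<^sub>+\<^sub>1)\<close> with weight
  \<open>\<tau>\<^sub>k\<^sub>+\<^sub>1\<close> and that for \<open>(x\<^sub>K, x\<^sub>k)\<close> with weight \<open>\<tau>\<^sub>k\<^sub>+\<^sub>1 - \<tau>\<^sub>k\<close>; what remains is
  a nonnegative multiple of \<open>|g\<^sub>k|\<^sup>2\<close>. Since \<open>U\<^sub>K = |g\<^sub>K|\<^sup>2 / L\<close>, the bound follows from
  \<open>U\<^sub>K \<le> U\<^sub>0\<close> and \<open>|g|\<^sup>2 / 2L \<le> f - f\<^sub>\<star>\<close> at both \<open>x\<^sub>0\<close> and \<open>x\<^sub>K\<close>.
\<close>

section \<open>Inequalities for smooth convex functions\<close>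

lemma has_real_derivative_along_line:
  fixes f :: "'a::euclidean_space \<Rightarrow> real"
  assumes "\<And>x. f differentiable (at x)"
  shows "((\<lambda>t. f (x + t *\<^sub>R d)) has_real_derivative grad f (x + t *\<^sub>R d) \<bullet> d) (at t)"
proof -
  have "GDERIV f (x + t *\<^sub>R d) :> grad f (x + t *\<^sub>R d)"
    using assms by (rule GDERIV_grad)
  then have "((\<lambda>t. f (x + t *\<^sub>R d)) has_derivative (\<lambda>s. (s *\<^sub>R d) \<bullet> grad f (x + t *\<^sub>R d))) (at t)"
    unfolding gderiv_def
    by (rule has_derivative_compose[rotated]) (auto intro!: derivative_eq_intros)
  then show ?thesis
    by (simp add: has_field_derivative_def inner_commute mult.commute[of _ "d \<bullet> _"])
qed

lemma convex_gradient_inequality: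
  fixes f :: "'a::euclidean_space \<Rightarrow> real"
  assumes "convex_on UNIV f" and diff: "\<And>x. f differentiable (at x)"
  shows "f x + grad f x \<bullet> (y - x) \<le> f y"
proof -
  define h where "h t = f (x + t *\<^sub>R (y - x))" for t
  have "convex_on UNIV h"
  proof (rule convex_onI)
    fix t a b :: real
    assume "0 < t" "t < 1"
    moreover have "x + ((1 - t) *\<^sub>R a + t *\<^sub>R b) *\<^sub>R (y - x)
        = (1 - t) *\<^sub>R (x + a *\<^sub>R (y - x)) + t *\<^sub>R (x + b *\<^sub>R (y - x))"
      by (simp add: algebra_simps)
    ultimately show "h ((1 - t) *\<^sub>R a + t *\<^sub>R b) \<le> (1 - t) * h a + t * h b"
      unfolding h_def using convex_onD[OF assms(1), of t] by simp
  qed simp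
  moreover have "(h has_real_derivative grad f x \<bullet> (y - x)) (at 0 within UNIV)"
    using has_real_derivative_along_line[OF diff, of x "y - x" 0] by (simp add: h_def[abs_def])
  ultimately have "grad f x \<bullet> (y - x) * (1 - 0) \<le> h 1 - h 0"
    by (intro convex_on_imp_above_tangent[where A = UNIV]) auto
  then show ?thesis by (simp add: h_def)
qed

lemma smooth_fun_differentiable: "smooth_fun L f \<Longrightarrow> f differentiable (at x)"
  by (simp add: smooth_fun_def)

text \<open>Along the segment, subtract the linear and quadratic terms of the bound from
  \<open>f\<close>; Cauchy-Schwarz and the Lipschitz bound make the derivative of the difference
  nonpositive.\<close>

lemma descent_inequality:
  fixes f :: "'a::euclidean_space \<Rightarrow> real"
  assumes "smooth_fun L f"
  shows "f y \<le> f x + grad f x \<bullet> (y - x) + L / 2 * (norm (y - x))\<^sup>2"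
proof -
  define d where "d = y - x"
  define h where "h t = f (x + t *\<^sub>R d) - t * (grad f x \<bullet> d) - L / 2 * t\<^sup>2 * (norm d)\<^sup>2" for t
  have "h 1 \<le> h 0"
  proof (rule DERIV_nonpos_imp_nonincreasing[of 0 1 h])
    fix t :: real
    assume t: "0 \<le> t" "t \<le> 1"
    define D where "D = grad f (x + t *\<^sub>R d) \<bullet> d - grad f x \<bullet> d - L * t * (norm d)\<^sup>2"
    have "(h has_real_derivative D) (at t)"
      unfolding h_def D_def
      by (rule derivative_eq_intros
            has_real_derivative_along_line[OF smooth_fun_differentiable[OF assms]] refl)+ simp
    moreover have "D \<le> 0"
    proof -
      have "(grad f (x + t *\<^sub>R d) - grad f x) \<bullet> d \<le> norm (grad f (x + t *\<^sub>R d) - grad f x) * norm d"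
        by (rule norm_cauchy_schwarz)
      also have "norm (grad f (x + t *\<^sub>R d) - grad f x) \<le> L * norm (t *\<^sub>R d)"
        using assms lipschitz_onD[of L UNIV "grad f" "x + t *\<^sub>R d" x]
        by (simp add: smooth_fun_def dist_norm)
      finally show ?thesis
        using t by (simp add: D_def inner_diff_left power2_eq_square mult_right_mono mult.assoc)
    qed
    ultimately show "\<exists>y. (h has_real_derivative y) (at t) \<and> y \<le> 0" by blast
  qed simp
  then show ?thesis by (simp add: h_def d_def)
qed

text \<open>Tilting \<open>f\<close> by the linear form of \<open>grad f y\<close> makes
  \<open>y\<close> a minimizer; a gradient step from \<open>x\<close> on the tilted function,
  landing at \<open>w\<close>, cannot go below its value at \<open>y\<close>.\<close>

lemma cocoercivity:
  fixes f :: "'a::euclidean_space \<Rightarrow> real"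
  assumes "L > 0" "convex_on UNIV f" "smooth_fun L f"
  shows "f y + grad f y \<bullet> (x - y) + (norm (grad f x - grad f y))\<^sup>2 / (2 * L) \<le> f x"
proof -
  define e where "e = grad f x - grad f y"
  define w where "w = x - (1 / L) *\<^sub>R e"
  have "f y + grad f y \<bullet> (w - y) \<le> f w"
    using assms(2) smooth_fun_differentiable[OF assms(3)] by (rule convex_gradient_inequality)
  also have "f w \<le> f x + grad f x \<bullet> (w - x) + L / 2 * (norm (w - x))\<^sup>2"
    using assms(3) by (rule descent_inequality)
  also have "(norm (w - x))\<^sup>2 = (norm e)\<^sup>2 / L\<^sup>2"
    by (simp add: w_def power_divide)
  finally have "f y + grad f y \<bullet> (x - y) + (grad f x - grad f y) \<bullet> (x - w) \<le> f x + L / 2 * ((norm e)\<^sup>2 / L\<^sup>2)"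
    by (simp add: algebra_simps)
  moreover have "(grad f x - grad f y) \<bullet> (x - w) = (norm e)\<^sup>2 / L"
    unfolding e_def[symmetric] by (simp add: w_def power2_norm_eq_inner)
  moreover have "L / 2 * ((norm e)\<^sup>2 / L\<^sup>2) = (norm e)\<^sup>2 / L - (norm e)\<^sup>2 / (2 * L)"
    using assms(1) by (simp add: field_simps power2_eq_square)
  ultimately show ?thesis unfolding e_def by linarith
qed

text \<open>Passing from \<open>x\<close> to \<open>grad_step L f x\<close> absorbs the cross term
  of the squared gradient difference, leaving separate squared norms as in the potential.\<close>

lemma cocoercivity_grad_step:
  fixes f :: "'a::euclidean_space \<Rightarrow> real"
  assumes "L > 0" "convex_on UNIV f" "smooth_fun L f"
  shows "f y + grad f y \<bullet> (grad_step L f x - y)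
           + ((norm (grad f x))\<^sup>2 + (norm (grad f y))\<^sup>2) / (2 * L) \<le> f x"
proof -
  have "grad f y \<bullet> (x - y) + (norm (grad f x - grad f y))\<^sup>2 / (2 * L)
      = grad f y \<bullet> (grad_step L f x - y) + ((norm (grad f x))\<^sup>2 + (norm (grad f y))\<^sup>2) / (2 * L)"
    by (simp add: grad_step_def power2_norm_eq_inner inner_diff_left inner_diff_right
        inner_commute[of "grad f x" "grad f y"] add_divide_distrib diff_divide_distrib)
  with cocoercivity[OF assms, of y x] show ?thesis by linarith
qed

lemma grad_norm_le_value_gap:
  fixes f :: "'a::euclidean_space \<Rightarrow> real"
  assumes "L > 0" "smooth_fun L f" "\<And>y. m \<le> f y"
  shows "(norm (grad f x))\<^sup>2 / (2 * L) \<le> f x - m"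
proof -
  have "m \<le> f (grad_step L f x)" by (rule assms(3))
  also have "\<dots> \<le> f x + grad f x \<bullet> (grad_step L f x - x) + L / 2 * (norm (grad_step L f x - x))\<^sup>2"
    using assms(2) by (rule descent_inequality)
  also have "\<dots> = f x - (norm (grad f x))\<^sup>2 / (2 * L)"
    using assms(1)
    by (simp add: grad_step_def power_divide power2_norm_eq_inner[symmetric])
      (simp add: field_simps power2_eq_square)
  finally show ?thesis by linarith
qed

section \<open>The potential and its decrease in one step\<close>

definition potential ::
    "real \<Rightarrow> ('a::euclidean_space \<Rightarrow> real) \<Rightarrow> 'a \<Rightarrow> real \<Rightarrow> real \<Rightarrow> 'a \<Rightarrow> 'a \<Rightarrow> 'a \<Rightarrow> real" where
  "potential L f xK t p x xp z =
     t * ((norm (grad f xK))\<^sup>2 / (2 * L) + (norm (grad f x))\<^sup>2 / (2 * L)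
          + f x - f xK - grad f x \<bullet> (x - xp))
     + L / p * ((z - xp) \<bullet> (z - grad_step L f xK))"

text \<open>Primes mark index k+1. \<open>x'\<close> may be any point: the inner product involving
  it cancels against the one in cocoercivity for \<open>(x, x')\<close>.\<close>

lemma potential_decrease:
  fixes f :: "'a::euclidean_space \<Rightarrow> real"
  assumes L: "L > 0" and f: "convex_on UNIV f" "smooth_fun L f"
    and p: "p > 0" "p' > 0" and t: "t \<le> t'" "0 \<le> t'"
    and a: "a = t * p - t' * p'" "a = p' * (t' - t) + 1" "a * (t' - t) \<le> t'"
    and x: "x = (p' / p) *\<^sub>R xp + (1 - p' / p) *\<^sub>R z"
    and z': "z' = z - (a / L) *\<^sub>R grad f x"
  shows "potential L f xK t' p' x' (grad_step L f x) z' \<le> potential L f xK t p x xp z"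
proof -
  \<comment> \<open>By the rule for \<open>x\<close>, both \<open>z - xp\<close> and
    \<open>x - xp\<close> are multiples of \<open>v\<close>.\<close>
  define g v w where "g = grad f x" and "v = z - x" and "w = z - grad_step L f xK"
  have v: "v = (p' / p) *\<^sub>R (z - xp)"
    by (simp add: v_def x algebra_simps)
  have zxp: "z - xp = (p / p') *\<^sub>R v"
    using p by (simp add: v)
  have xxp: "x - xp = (p / p' - 1) *\<^sub>R v"
    using zxp by (simp add: v_def algebra_simps)
  define N N' G where "N = (norm (grad f xK))\<^sup>2" and "N' = (norm (grad f x'))\<^sup>2" and "G = (norm g)\<^sup>2"
  define I where "I = grad f x' \<bullet> (x' - grad_step L f x)"
  have U: "potential L f xK t p x xp z
      = t * (N / (2 * L) + G / (2 * L) + f x - f xK - (p / p' - 1) * (g \<bullet> v)) + L / p' * (v \<bullet> w)"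
    using p by (simp add: potential_def N_def G_def g_def[symmetric] w_def[symmetric] zxp xxp)
  have z1: "z' - grad_step L f x = v - ((a - 1) / L) *\<^sub>R g"
    by (simp add: z' grad_step_def v_def g_def diff_divide_distrib algebra_simps)
  have z2: "z' - grad_step L f xK = w - (a / L) *\<^sub>R g"
    by (simp add: z' w_def g_def algebra_simps)
  have gg: "g \<bullet> g = G" by (simp add: G_def power2_norm_eq_inner)
  have prod: "(z' - grad_step L f x) \<bullet> (z' - grad_step L f xK)
      = v \<bullet> w - a / L * (g \<bullet> v) - (a - 1) / L * (g \<bullet> w) + (a - 1) / L * (a / L) * G"
    unfolding z1 z2
    by (simp only: inner_diff_left inner_diff_right inner_scaleR_left inner_scaleR_right gg
        inner_commute[of v g]) (simp add: diff_divide_distrib algebra_simps)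
  \<comment> \<open>This gives \<open>g \<bullet> w\<close> the coefficient \<open>t' - t\<close>,
    the weight of cocoercivity for \<open>(xK, x)\<close>.\<close>
  have am1: "(a - 1) = p' * (t' - t)" using a(2) by simp
  have "L / p' * ((z' - grad_step L f x) \<bullet> (z' - grad_step L f xK))
      = L / p' * (v \<bullet> w) - a / p' * (g \<bullet> v) - (t' - t) * (g \<bullet> w) + (t' - t) * a * (G / L)"
    unfolding prod am1 using L p by (simp add: field_simps)
  then have U': "potential L f xK t' p' x' (grad_step L f x) z'
      = t' * (N / (2 * L) + N' / (2 * L) + f x' - f xK - I)
        + (L / p' * (v \<bullet> w) - a / p' * (g \<bullet> v) - (t' - t) * (g \<bullet> w) + (t' - t) * a * (G / L))"
    by (simp add: potential_def N_def N'_def I_def)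
  \<comment> \<open>The coefficients of \<open>g \<bullet> v\<close> before and after the step
    differ by the same weight \<open>t' - t\<close>.\<close>
  have gv: "a / p' = t * (p / p' - 1) - (t' - t)"
    unfolding a(1) using p by (simp add: field_simps)
  have "f x' - I + G / (2 * L) + N' / (2 * L) \<le> f x"
    using cocoercivity_grad_step[OF L f, of x' x]
    by (simp add: I_def G_def N'_def g_def inner_diff_right add_divide_distrib)
  then have 1: "t' * (f x' - I + G / (2 * L) + N' / (2 * L)) \<le> t' * f x"
    using t by (intro mult_left_mono)
  have "f x + g \<bullet> (v - w) + N / (2 * L) + G / (2 * L) \<le> f xK"
    using cocoercivity_grad_step[OF L f, of x xK]
    by (simp add: N_def G_def g_def v_def w_def add_divide_distrib)
  then have 2: "(t' - t) * (f x + (g \<bullet> v - g \<bullet> w) + N / (2 * L) + G / (2 * L)) \<le> (t' - t) * f xK"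
    using t by (intro mult_left_mono) (auto simp: inner_diff_right)
  have 3: "a * (t' - t) * (G / L) \<le> t' * (G / L)"
    using a(3) L by (intro mult_right_mono) (auto simp: G_def)
  \<comment> \<open>The drop of the potential is the sum of the slacks in \<open>1\<close>,
    \<open>2\<close> and \<open>3\<close>. Free scalars replace the quotients (\<open>q\<close> for
    \<open>G / (2 * L)\<close>, \<open>s\<close> for \<open>p / p' - 1\<close>), so that the
    identity is polynomial.\<close>
  have split: "t * (n + q + y - yK - s * gv) + vw
        - (t' * (n + n' + y' - yK - i)
           + (vw - (t * s - (t' - t)) * gv - (t' - t) * gw + (t' - t) * a * (2 * q)))
      = (t' * y - t' * (y' - i + q + n'))
        + ((t' - t) * yK - (t' - t) * (y + (gv - gw) + n + q))
        + (t' * (2 * q) - a * (t' - t) * (2 * q))" for n n' q y y' yK s i gv gw vw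
    by algebra
  have "G / L = 2 * (G / (2 * L))" by simp
  then show ?thesis
    using 1 2 3
      split[of "N / (2 * L)" "G / (2 * L)" "f x" "f xK" "p / p' - 1" "g \<bullet> v" "L / p' * (v \<bullet> w)"
        "N' / (2 * L)" "f x'" I "g \<bullet> w"]
    unfolding U U' gv by argo
qed

section \<open>Telescoping and the two endpoints\<close>

theorem theorem7:
  fixes f :: "real ^ 'n \<Rightarrow> real" and L :: real and K :: nat
    and \<phi> \<tau> :: "nat \<Rightarrow> real" and x z :: "nat \<Rightarrow> real ^ 'n"
  assumes "L > 0"
    and "convex_on UNIV f"
    and "smooth_fun L f"
    and "K \<ge> 1"
    and "\<forall>k\<le>K + 1. \<phi> k \<ge> 0"
    and "\<forall>k\<le>K. \<tau> k \<ge> 0"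
    and "mono_on {0..K} \<tau>"
    and "\<phi> (K + 1) = 0" and "\<phi> K = 1" and "\<tau> K = 1"
    and "\<forall>k<K. \<tau> k * \<phi> k - \<tau> (k + 1) * \<phi> (k + 1)
                = \<phi> (k + 1) * (\<tau> (k + 1) - \<tau> k) + 1"
    and "\<forall>k<K. (\<tau> k * \<phi> k - \<tau> (k + 1) * \<phi> (k + 1)) * (\<tau> (k + 1) - \<tau> k) \<le> \<tau> (k + 1)"
    and "z 0 = x 0"
    and "\<forall>k\<le>K. x k = (\<phi> (k + 1) / \<phi> k) *\<^sub>R prev_plus L f x k
                    + (1 - \<phi> (k + 1) / \<phi> k) *\<^sub>R z k"
    and "\<forall>k<K. z (k + 1) = z k - ((\<tau> k * \<phi> k - \<tau> (k + 1) * \<phi> (k + 1)) / L) *\<^sub>R grad f (x k)"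
  shows "ereal ((norm (grad f (x K)))\<^sup>2)
           \<le> ereal (2 * L * \<tau> 0) * (ereal (f (x 0)) - inf_value f)"
proof -
  note L = \<open>L > 0\<close> and f = \<open>convex_on UNIV f\<close> \<open>smooth_fun L f\<close>
  define xK where "xK = x K"
  define a where "a k = \<tau> k * \<phi> k - \<tau> (k + 1) * \<phi> (k + 1)" for k
  have \<phi>_nonneg: "\<phi> k \<ge> 0" if "k \<le> K + 1" for k using assms(5) that by blast
  have \<tau>_nonneg: "\<tau> k \<ge> 0" if "k \<le> K" for k using assms(6) that by blast
  have mono: "\<tau> k \<le> \<tau> (k + 1)" if "k < K" for k
    using assms(7) that by (auto intro: mono_onD)
  have a: "a k = \<phi> (k + 1) * (\<tau> (k + 1) - \<tau> k) + 1" "a k * (\<tau> (k + 1) - \<tau> k) \<le> \<tau> (k + 1)"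
    if "k < K" for k
    using assms(11,12) that by (auto simp: a_def)
  \<comment> \<open>Since \<open>a k \<ge> 1\<close>, the product is in fact at least 1.\<close>
  have pos: "\<tau> k * \<phi> k > 0" if "k < K" for k
  proof -
    have "0 \<le> \<phi> (k + 1) * (\<tau> (k + 1) - \<tau> k)" "0 \<le> \<tau> (k + 1) * \<phi> (k + 1)"
      using mono \<phi>_nonneg \<tau>_nonneg that by simp_all
    then show ?thesis using a(1)[OF that] unfolding a_def by linarith
  qed
  have \<phi>_pos: "\<phi> k > 0" if "k \<le> K" for k
  proof (cases "k = K")
    case False
    with that pos[of k] \<phi>_nonneg[of k] show ?thesis
      by (cases "\<phi> k = 0") auto
  qed (simp add: assms(9))
  \<comment> \<open>Strictness matters when the infimum is -\<infinity>, because 0 * \<infinity> = 0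
    in \<open>ereal\<close>.\<close>
  have \<tau>0: "\<tau> 0 > 0"
    using pos[of 0] \<tau>_nonneg[of 0] \<open>K \<ge> 1\<close> by (cases "\<tau> 0 = 0") auto
  define U where "U k = potential L f xK (\<tau> k) (\<phi> k) (x k) (prev_plus L f x k) (z k)" for k
  have step: "U (Suc k) \<le> U k" if "k < K" for k
    using potential_decrease[OF L f \<phi>_pos[of k] \<phi>_pos[of "k + 1"] mono[of k] \<tau>_nonneg[of "k + 1"]
        a_def[of k] a[of k], of "x k" "prev_plus L f x k" "z k" "z (k + 1)" xK "x (k + 1)"]
      assms(14,15) that
    by (simp add: U_def a_def)
  have decr: "U k \<le> U 0" if "k \<le> K" for k
    using that by (induction k) (auto intro: order.trans[OF step])
  \<comment> \<open>\<open>\<phi> (K + 1) = 0\<close> puts the last iterate at \<open>z K\<close>.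
    The two inner products in \<open>U K\<close> then cancel, as
    \<open>z K - grad_step L f xK\<close> is the gradient over \<open>L\<close>.\<close>
  have "x K = z K"
    using assms(8,14) by auto
  then have UK: "U K = (norm (grad f xK))\<^sup>2 / L"
    using L by (simp add: U_def potential_def xK_def assms(9,10) grad_step_def
        power2_norm_eq_inner inner_commute field_simps)
  have U0: "U 0 = \<tau> 0 * ((norm (grad f xK))\<^sup>2 / (2 * L) + (norm (grad f (x 0)))\<^sup>2 / (2 * L)
      + f (x 0) - f xK)"
    by (simp add: U_def potential_def assms(13))
  have key: "(norm (grad f xK))\<^sup>2 \<le> 2 * L * \<tau> 0 * (f (x 0) - m)" if m: "\<And>y. m \<le> f y" for m
  proof -
    have "(norm (grad f xK))\<^sup>2 / L \<le> U 0"
      using decr[of K] by (simp add: UK)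
    also have "\<dots> \<le> \<tau> 0 * (2 * (f (x 0) - m))"
    proof -
      \<comment> \<open>With \<open>c\<close> and \<open>d\<close> the values at \<open>x 0\<close>
        and \<open>xK\<close>, the gap bound at \<open>xK\<close> cancels the unknown value
        \<open>d\<close>.\<close>
      have "p + q + c - d \<le> 2 * (c - m)" if "p \<le> d - m" "q \<le> c - m" for p q c d
        using that by simp
      from this[OF grad_norm_le_value_gap[OF L f(2) m] grad_norm_le_value_gap[OF L f(2) m]]
      show ?thesis
        unfolding U0 using \<tau>0 by (intro mult_left_mono) auto
    qed
    finally show ?thesis using L by (simp add: field_simps)
  qed
  show ?thesis
  proof (cases "inf_value f")
    case (real m)
    have "m \<le> f y" for y
    proof -
      have "inf_value f \<le> ereal (f y)" unfolding inf_value_def by (rule INF_lower) simp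
      then show ?thesis by (simp add: real)
    qed
    from key[OF this] show ?thesis by (simp add: real xK_def)
  next
    case PInf
    have "inf_value f \<le> ereal (f 0)" unfolding inf_value_def by (rule INF_lower) simp
    with PInf show ?thesis by simp
  next
    case MInf
    then show ?thesis using L \<tau>0 by simp
  qed
qed

end
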